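(* There is an absolute constant $C>0$ such that the following holds. Let $G$ be a strongly regular graph with parameters $(n,k,\lambda,\mu)$, $k\le (n-1)/2$, and adjacency eigenvalues $k\ge r>s$, satisfying the claw bound \[ r \le \max\left\{2(-s-1)(\mu+1+s)+s,\ \frac{s(s+1)(\mu+1)}{2}-1\right\}. \] Then $\lambda/n \le C\, h(n,k)$, where \[ h(n,k) = \min\left\{\left(\frac{k}{n}\right)^{4/3},\ \max\left\{\frac{k^{1/2}}{n^{3/4}},\ \left(\frac{k}{n}\right)^2\right\},\ \max\left\{\left(\frac{k}{n}\right)^{3/2},\ \left(\frac{1}{n}\right)^{1/2}\right\}\right\}. \]
   Context: A strongly regular graph with parameters $(n,k,\lambda,\mu)$ is a $k$-regular graph on $n$ vertices in which any two adjacent vertices have exactly $\lambda$ common neighbors and any two distinct nonadjacent vertices have exactly $\mu$ common neighbors. Its adjacency eigenvalues are $k$ and two other (restricted) eigenvalues $r>s$, with $k\ge r$. *)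

theory Defs
  imports "Jordan_Normal_Form.Char_Poly"
begin

definition simple_graph :: "nat \<Rightarrow> (nat \<Rightarrow> nat \<Rightarrow> bool) \<Rightarrow> bool" where
  "simple_graph n E \<longleftrightarrow>
     (\<forall>i<n. \<not> E i i) \<and> (\<forall>i<n. \<forall>j<n. E i j \<longrightarrow> E j i)"

definition adj_mat :: "nat \<Rightarrow> (nat \<Rightarrow> nat \<Rightarrow> bool) \<Rightarrow> real mat" where
  "adj_mat n E = mat n n (\<lambda>(i,j). if E i j then 1 else 0)"

definition strongly_regular ::
  "nat \<Rightarrow> (nat \<Rightarrow> nat \<Rightarrow> bool) \<Rightarrow> nat \<Rightarrow> nat \<Rightarrow> nat \<Rightarrow> bool" where
  "strongly_regular n E k lam mu \<longleftrightarrow>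
     simple_graph n E \<and>
     (\<forall>i<n. card {j. j < n \<and> E i j} = k) \<and>
     (\<forall>i<n. \<forall>j<n. i \<noteq> j \<and> E i j \<longrightarrow> card {l. l < n \<and> E i l \<and> E j l} = lam) \<and>
     (\<forall>i<n. \<forall>j<n. i \<noteq> j \<and> \<not> E i j \<longrightarrow> card {l. l < n \<and> E i l \<and> E j l} = mu)"

definition srg_eigenvalues :: "nat \<Rightarrow> (nat \<Rightarrow> nat \<Rightarrow> bool) \<Rightarrow> nat \<Rightarrow> real \<Rightarrow> real \<Rightarrow> bool" where
  "srg_eigenvalues n E k r s \<longleftrightarrow>
     eigenvalue (adj_mat n E) (real k) \<and> eigenvalue (adj_mat n E) r \<and> eigenvalue (adj_mat n E) s \<and>
     real k \<ge> r \<and> r > s \<and>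
     (\<forall>x. eigenvalue (adj_mat n E) x \<longrightarrow> x \<in> {real k, r, s})"

definition h_fun :: "nat \<Rightarrow> nat \<Rightarrow> real" where
  "h_fun n k = min ((real k / real n) powr (4/3))
                (min (max (real k powr (1/2) / real n powr (3/4)) ((real k / real n) powr 2))
                     (max ((real k / real n) powr (3/2)) ((1 / real n) powr (1/2))))"

end

theory Submission
  imports Defs
begin

text \<open>Write \<open>m = - s\<close>. One has \<open>lam \<le> mu + r\<close>, \<open>r m \<le> k\<close> and \<open>mu = O(k\<^sup>2 / n)\<close>, so that only
  \<open>r\<close> has to be bounded.

  The claw bound gives \<open>r \<le> 2 m\<^sup>2 mu\<close>, hence \<open>r\<^sup>3 \<le> 2 k\<^sup>2 mu = O(k\<^sup>4 / n)\<close>: the first term of \<open>h_fun\<close>.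

  The projection onto the eigenspace of \<open>r\<close> has rank \<open>f \<le> n m / r\<close>, constant diagonal and only
  two values off the diagonal; multiplying two shifts of it entrywise gives a nonzero multiple of
  the identity, so \<open>n \<le> (f + 1)\<^sup>2\<close> and \<open>r\<^sup>2 = O(k n\<^bsup>1/2\<^esup>)\<close>: the second term.

  For the third term, suppose \<open>lam\<^sup>2 > 16 k mu\<close>. Then all but a quarter of the neighbours of any
  vertex are covered by at most \<open>2 k / lam\<close> cliques of size almost \<open>lam\<close>. Large cliques at two
  nonadjacent vertices share at most one vertex, and averaging over the \<open>mu\<close> paths between such
  vertices yields \<open>mu lam\<^sup>2 \<le> 8 k\<^sup>2\<close>, that is \<open>lam = O(n\<^bsup>1/2\<^esup>)\<close> unless \<open>lam\<close> is comparable
  to \<open>k\<close>; in that case the first bound forces \<open>k\<close> to be comparable to \<open>n\<close>.\<close>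

section \<open>Large cliques in strongly regular graphs\<close>

locale srg =
  fixes n :: nat and E :: "nat \<Rightarrow> nat \<Rightarrow> bool" and k lam mu :: nat
  assumes srg: "strongly_regular n E k lam mu"
begin

definition nb :: "nat \<Rightarrow> nat set" where
  "nb x = {j. j < n \<and> E x j}"

definition nonnb :: "nat \<Rightarrow> nat set" where
  "nonnb x = {j. j < n \<and> j \<noteq> x \<and> \<not> E x j}"

lemma finite_nb [simp]: "finite (nb x)" and finite_nonnb [simp]: "finite (nonnb x)"
  by (auto simp: nb_def nonnb_def)

lemma nb_iff: "y \<in> nb x \<longleftrightarrow> y < n \<and> E x y"
  by (auto simp: nb_def)

lemma edge_sym: "x < n \<Longrightarrow> y < n \<Longrightarrow> E x y \<Longrightarrow> E y x"
  using srg by (auto simp: strongly_regular_def simple_graph_def)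

lemma nb_sym: "x < n \<Longrightarrow> y \<in> nb x \<Longrightarrow> x \<in> nb y"
  using srg by (auto simp: nb_def strongly_regular_def simple_graph_def)

lemma nb_irrefl: "x \<notin> nb x"
  using srg by (auto simp: nb_def strongly_regular_def simple_graph_def)

lemma card_nb: "x < n \<Longrightarrow> card (nb x) = k"
  using srg by (auto simp: nb_def strongly_regular_def)

lemma nb_Int: "nb x \<inter> nb y = {l. l < n \<and> E x l \<and> E y l}"
  by (auto simp: nb_def)

lemma card_nb_Int_adj: "x < n \<Longrightarrow> y \<in> nb x \<Longrightarrow> card (nb x \<inter> nb y) = lam"
  using srg nb_irrefl[of x] unfolding nb_Int strongly_regular_def by (auto simp: nb_iff)

lemma card_nb_Int_nonadj:
  "x < n \<Longrightarrow> y < n \<Longrightarrow> y \<noteq> x \<Longrightarrow> y \<notin> nb x \<Longrightarrow> card (nb x \<inter> nb y) = mu"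
  using srg unfolding nb_Int strongly_regular_def by (auto simp: nb_iff)

lemma card_nonnb:
  assumes "x < n"
  shows "card (nonnb x) = n - k - 1"
proof -
  have "nonnb x = {..<n} - insert x (nb x)" by (auto simp: nonnb_def nb_def)
  then show ?thesis
    using assms nb_irrefl[of x] card_nb[of x] by (simp add: card_Diff_subset nb_iff subset_iff)
qed

text \<open>Double counting of the edges between \<open>B\<close> and \<open>nonnb x\<close>: of the
  \<open>k\<close> neighbours of a vertex \<open>w\<close> in \<open>B\<close>, exactly
  \<open>x\<close> and the \<open>lam\<close> common neighbours of \<open>w\<close> and
  \<open>x\<close> lie outside \<open>nonnb x\<close>. Applied to all of \<open>nb x\<close>, and
  later to the part of \<open>nb x\<close> missed by the cliques.\<close>

lemma sum_card_nonnb: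
  assumes x: "x < n" and B: "B \<subseteq> nb x"
  shows "(\<Sum>z\<in>nonnb x. card (nb z \<inter> B)) = card B * (k - lam - 1)"
proof -
  have fB: "finite B" by (rule finite_subset[OF B finite_nb])
  have "card {z \<in> nonnb x. w \<in> nb z} = k - lam - 1" if w: "w \<in> B" for w
  proof -
    have wx: "w \<in> nb x" "w < n" using w B by (auto simp: nb_iff)
    have xw: "x \<in> nb w" using nb_sym x wx by blast
    have "{z \<in> nonnb x. w \<in> nb z} = nb w - insert x (nb x \<inter> nb w)"
      using wx by (auto simp: nonnb_def nb_iff intro: edge_sym)
    moreover have "insert x (nb x \<inter> nb w) \<subseteq> nb w" using xw by auto
    ultimately show ?thesis
      using card_nb_Int_adj[OF x wx(1)] card_nb[OF wx(2)] nb_irrefl[of x]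
      by (simp add: card_Diff_subset)
  qed
  then have "(\<Sum>z\<in>nonnb x. card {w \<in> B. w \<in> nb z}) = (\<Sum>w\<in>B. k - lam - 1)"
    by (intro sum_multicount_gen) (auto simp: fB)
  moreover have "{w \<in> B. w \<in> nb z} = nb z \<inter> B" for z by auto
  ultimately show ?thesis by simp
qed

text \<open>With \<open>B = nb 0\<close>, every summand of the double count is
  \<open>mu\<close>.\<close>

lemma parameter_identity:
  assumes "0 < n"
  shows "k * (k - lam - 1) = (n - k - 1) * mu"
proof -
  have "card (nb z \<inter> nb 0) = mu" if "z \<in> nonnb 0" for z
    using card_nb_Int_nonadj[OF assms, of z] that by (auto simp: nonnb_def nb_iff Int_commute)
  then have "(\<Sum>z\<in>nonnb 0. card (nb z \<inter> nb 0)) = (n - k - 1) * mu"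
    by (simp add: card_nonnb assms)
  then show ?thesis using sum_card_nonnb[OF assms, of "nb 0"] by (simp add: card_nb assms)
qed

section \<open>Stars, independent sets and clique covers\<close>

text \<open>For \<open>y\<close> in \<open>nb x\<close> this is the closed neighbourhood of
  \<open>y\<close> in the graph induced on \<open>nb x\<close>.\<close>

definition star :: "nat \<Rightarrow> nat \<Rightarrow> nat set" where
  "star x y = insert y (nb x \<inter> nb y)"

text \<open>The private neighbourhood of \<open>y\<close> with respect to \<open>Y\<close>; these
  sets become the cliques of the cover.\<close>

definition own :: "nat \<Rightarrow> nat set \<Rightarrow> nat \<Rightarrow> nat set" where
  "own x Y y = star x y - (\<Union>y'\<in>Y - {y}. star x y')"

definition indep :: "nat set \<Rightarrow> bool" where
  "indep Y \<longleftrightarrow> (\<forall>y\<in>Y. \<forall>y'\<in>Y. y' \<notin> nb y)"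

lemma finite_star [simp]: "finite (star x y)"
  by (simp add: star_def)

lemma star_subset: "y \<in> nb x \<Longrightarrow> star x y \<subseteq> nb x"
  by (auto simp: star_def)

lemma card_star: "x < n \<Longrightarrow> y \<in> nb x \<Longrightarrow> card (star x y) = lam + 1"
  using card_nb_Int_adj[of x y] nb_irrefl[of y] by (simp add: star_def)

lemma lam_less_k:
  assumes "x < n" "0 < k"
  shows "lam < k"
proof -
  obtain y where y: "y \<in> nb x" using card_nb[OF assms(1)] assms(2) by fastforce
  then have "card (star x y) \<le> card (nb x)" by (intro card_mono star_subset) auto
  then show ?thesis using card_star[OF assms(1) y] card_nb[OF assms(1)] by simp
qed

text \<open>Neither centre lies in the star of the other, so the overlap consists of common
  neighbours of two nonadjacent vertices.\<close>

lemma card_star_Int: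
  assumes "x < n" "y \<in> nb x" "y' \<in> nb x" "y \<noteq> y'" "y' \<notin> nb y"
  shows "card (star x y \<inter> star x y') \<le> mu"
proof -
  have yn: "y < n" "y' < n" using assms by (auto simp: nb_iff)
  have "y \<notin> nb y'" using nb_sym[of y'] yn assms(5) by blast
  then have "star x y \<inter> star x y' \<subseteq> nb y \<inter> nb y'" using assms by (auto simp: star_def)
  then have "card (star x y \<inter> star x y') \<le> card (nb y \<inter> nb y')" by (intro card_mono) auto
  then show ?thesis using card_nb_Int_nonadj[of y y'] yn assms by auto
qed

text \<open>The star of \<open>y\<close> has \<open>lam + 1\<close> vertices and loses at most
  \<open>mu\<close> of them to each other star.\<close>

lemma card_own:
  assumes x: "x < n" and Y: "Y \<subseteq> nb x" "indep Y" and y: "y \<in> Y"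
  shows "lam \<le> card (own x Y y) + card Y * mu"
proof -
  have fY: "finite Y" by (rule finite_subset[OF Y(1) finite_nb])
  let ?O = "\<Union>y'\<in>Y - {y}. star x y \<inter> star x y'"
  have "card ?O \<le> (\<Sum>y'\<in>Y - {y}. card (star x y \<inter> star x y'))"
    by (rule card_UN_le) (simp add: fY)
  also have "\<dots> \<le> (\<Sum>y'\<in>Y - {y}. mu)"
    using x Y y by (intro sum_mono card_star_Int) (auto simp: indep_def)
  also have "\<dots> \<le> card Y * mu" using fY by (simp add: card_Diff_singleton_if)
  finally have "card ?O \<le> card Y * mu" .
  moreover have "own x Y y = star x y - ?O" by (auto simp: own_def)
  then have "card (star x y) - card ?O \<le> card (own x Y y)"
    by (simp add: diff_card_le_card_Diff fY)
  moreover have "card (star x y) = lam + 1" using card_star x Y y by auto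
  ultimately show ?thesis by linarith
qed

text \<open>Private neighbourhoods are pairwise disjoint subsets of \<open>nb x\<close>, so their
  sizes add up to at most \<open>k\<close>.\<close>

lemma card_indep_le:
  assumes x: "x < n" and Y: "Y \<subseteq> nb x" "indep Y"
  shows "card Y * lam \<le> k + card Y * (card Y * mu)"
proof -
  have fY: "finite Y" by (rule finite_subset[OF Y(1) finite_nb])
  have fP: "finite (own x Y y)" for y by (simp add: own_def)
  have "(\<Sum>y\<in>Y. card (own x Y y)) = card (\<Union>y\<in>Y. own x Y y)"
    by (rule card_UN_disjoint[symmetric]) (auto simp: fY fP own_def)
  also have "\<dots> \<le> card (nb x)"
    using Y(1) star_subset[of _ x] by (intro card_mono finite_nb) (fastforce simp: own_def)
  finally have P: "(\<Sum>y\<in>Y. card (own x Y y)) \<le> k" using card_nb[OF x] by simp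
  have "card Y * lam = (\<Sum>y\<in>Y. lam)" by simp
  also have "\<dots> \<le> (\<Sum>y\<in>Y. card (own x Y y) + card Y * mu)"
    by (intro sum_mono card_own x Y)
  also have "\<dots> \<le> k + card Y * (card Y * mu)"
    using P by (simp add: sum.distrib)
  finally show ?thesis .
qed

text \<open>The inequality of \<open>card_indep_le\<close> is quadratic in the size of
  \<open>Y\<close> and fails for sizes just above \<open>2 * k / lam\<close>. Subsets of independent
  sets are independent, so a larger \<open>Y\<close> would contain a subset of such a forbidden
  size.\<close>

lemma card_indep_bound:
  assumes x: "x < n" and Y: "Y \<subseteq> nb x" "indep Y"
    and big: "16 * k * mu < lam\<^sup>2"
  shows "card Y * lam \<le> 2 * k"
proof (rule ccontr)
  assume neg: "\<not> card Y * lam \<le> 2 * k"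
  have fY: "finite Y" by (rule finite_subset[OF Y(1) finite_nb])
  \<comment> \<open>The least integer with \<open>T * lam > 2 * k\<close>; since
    \<open>lam < k\<close>, it satisfies \<open>T * lam \<le> 3 * k\<close>.\<close>
  define T where "T = 2 * k div lam + 1"
  have lam0: "0 < lam" using big by (cases lam) auto
  have "0 < k"
    using neg Y card_nb[OF x] by (cases k) (auto simp: subset_iff)
  then have kl: "lam < k" using lam_less_k x by blast
  have T1: "2 * k < T * lam"
    using dividend_less_div_times[OF lam0, of "2 * k"] by (simp add: T_def)
  have T2: "T * lam \<le> 3 * k"
  proof -
    have "T * lam = lam + 2 * k div lam * lam" by (simp add: T_def)
    then show ?thesis using kl div_times_less_eq_dividend[of "2 * k" lam] by linarith
  qed
  have "T \<le> card Y"
    using less_mult_imp_div_less[of "2 * k" "card Y" lam] neg by (simp add: T_def)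
  then obtain Z where Z: "Z \<subseteq> Y" "card Z = T" by (metis obtain_subset_with_card_n)
  have "indep Z" using Y Z by (auto simp: indep_def)
  then have "T * lam \<le> k + T * (T * mu)" using card_indep_le[OF x, of Z] Y Z by auto
  then have 1: "real T * lam \<le> k + real T * (real T * mu)"
    unfolding of_nat_le_iff[where 'a = real, symmetric] by simp
  have T1': "2 * real k < real T * lam" using T1[folded of_nat_less_iff[where 'a = real]] by (simp only: of_nat_mult of_nat_numeral)
  have T2': "real T * lam \<le> 3 * real k" using T2[folded of_nat_le_iff[where 'a = real]] by (simp only: of_nat_mult of_nat_numeral)
  have big': "16 * real k * mu < real lam ^ 2"
    using big[folded of_nat_less_iff[where 'a = real]] by (simp only: of_nat_mult of_nat_power of_nat_numeral)
  have "(real T * mu) * lam \<le> 3 * real k * mu" using mult_right_mono[OF T2', of mu] by (simp add: algebra_simps)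
  also have "\<dots> \<le> 3 / 16 * real lam * lam" using big' by (simp add: power2_eq_square)
  finally have "real T * mu \<le> 3 / 16 * lam" using lam0 by simp
  then have "real T * (real T * mu) \<le> real T * (3 / 16 * lam)" by (intro mult_left_mono) auto
  \<comment> \<open>At least 13/16 of \<open>T * lam\<close> survives, which exceeds
    \<open>k\<close> because \<open>T * lam > 2 * k\<close>.\<close>
  then show False using 1 T1' \<open>0 < k\<close> by (simp add: algebra_simps)
qed

text \<open>Take a maximum independent set \<open>Y\<close> among the neighbours of \<open>x\<close>. Two nonadjacent vertices
  in the private neighbourhood of some \<open>y \<in> Y\<close> could replace \<open>y\<close>, so private neighbourhoods are
  cliques.\<close>

lemma clique_cover:
  assumes x: "x < n" and big: "16 * k * mu < lam\<^sup>2"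
  obtains \<K> where "finite \<K>" "card \<K> * lam \<le> 2 * k"
    "\<And>K. K \<in> \<K> \<Longrightarrow> K \<subseteq> nb x \<and> 7 * lam \<le> 8 * card K"
    "\<And>K u v. K \<in> \<K> \<Longrightarrow> u \<in> K \<Longrightarrow> v \<in> K \<Longrightarrow> u \<noteq> v \<Longrightarrow> v \<in> nb u"
    "4 * card (nb x - \<Union>\<K>) \<le> k"
proof -
  let ?P = "\<lambda>Y. Y \<subseteq> nb x \<and> indep Y"
  have "?P {}" by (auto simp: indep_def)
  moreover have "\<forall>Y. ?P Y \<longrightarrow> card Y < Suc k"
    using card_nb[OF x] card_mono[OF finite_nb, of _ x] by (metis le_imp_less_Suc)
  ultimately have "\<exists>Y. ?P Y \<and> (\<forall>Z. ?P Z \<longrightarrow> card Z \<le> card Y)"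
    by (rule ex_has_greatest_nat)
  then obtain Y where Y: "Y \<subseteq> nb x" "indep Y" and max: "\<And>Z. ?P Z \<Longrightarrow> card Z \<le> card Y"
    by blast
  have fY: "finite Y" by (rule finite_subset[OF Y(1) finite_nb])
  have lam0: "0 < lam" using big by (cases lam) auto
  have t: "card Y * lam \<le> 2 * k" by (rule card_indep_bound[OF x Y big])
  have t': "real (card Y) * lam \<le> 2 * real k" using t[folded of_nat_le_iff[where 'a = real]] by (simp only: of_nat_mult of_nat_numeral)
  have big': "16 * real k * mu < real lam ^ 2"
    using big[folded of_nat_less_iff[where 'a = real]] by (simp only: of_nat_mult of_nat_power of_nat_numeral)
  \<comment> \<open>All other stars together take at most \<open>lam / 8\<close> from one star; this
    is the source of the fraction 7/8.\<close>
  have "(real (card Y) * mu) * lam \<le> 2 * real k * mu"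
    using mult_right_mono[OF t', of mu] by (simp add: algebra_simps)
  also have "\<dots> \<le> 1 / 8 * real lam * lam" using big' by (simp add: power2_eq_square)
  finally have tmu: "real (card Y) * mu \<le> 1 / 8 * lam" using lam0 by simp
  define \<K> where "\<K> = own x Y ` Y"
  have "card \<K> \<le> card Y" using fY by (simp add: \<K>_def card_image_le)
  then have c1: "card \<K> * lam \<le> 2 * k" using t by (meson le_trans mult_le_mono1)
  have c2: "K \<subseteq> nb x \<and> 7 * lam \<le> 8 * card K" if K: "K \<in> \<K>" for K
  proof -
    obtain y where y: "y \<in> Y" "K = own x Y y" using K by (auto simp: \<K>_def)
    have "lam \<le> card K + card Y * mu" using card_own[OF x Y] y by simp
    then have "real lam \<le> card K + real (card Y) * mu" by (metis of_nat_add of_nat_le_iff of_nat_mult)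
    then have "7 * lam \<le> 8 * card K" using tmu by linarith
    moreover have "K \<subseteq> nb x" using y Y star_subset[of y x] by (auto simp: own_def)
    ultimately show ?thesis by simp
  qed
  have c3: "v \<in> nb u" if K: "K \<in> \<K>" and uv: "u \<in> K" "v \<in> K" "u \<noteq> v" for K u v
  proof (rule ccontr)
    assume nadj: "v \<notin> nb u"
    obtain y where y: "y \<in> Y" "K = own x Y y" using K by (auto simp: \<K>_def)
    have un: "u < n" "v < n" "u \<in> nb x" "v \<in> nb x" using c2[OF K] uv by (auto simp: nb_iff)
    have nadj': "u \<notin> nb v" using nadj nb_sym un by blast
    have yn: "\<And>y'. y' \<in> Y \<Longrightarrow> y' < n" using Y by (auto simp: nb_iff)
    have ns: "w \<notin> star x y'" if "w \<in> K" "y' \<in> Y - {y}" for w y'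
      using that y by (auto simp: own_def)
    have sep: "w \<noteq> y' \<and> w \<notin> nb y' \<and> y' \<notin> nb w" if "w \<in> K" "y' \<in> Y - {y}" for w y'
      using ns[OF that] that c2[OF K] nb_sym[of w y'] by (auto simp: star_def nb_iff)
    \<comment> \<open>Exchanging \<open>y\<close> for the two vertices \<open>u\<close> and
      \<open>v\<close> enlarges \<open>Y\<close>, against maximality.\<close>
    let ?Z = "insert u (insert v (Y - {y}))"
    have "indep ?Z"
      using Y(2) sep uv nadj nadj' nb_irrefl unfolding indep_def by blast
    moreover have "?Z \<subseteq> nb x" using un Y by auto
    ultimately have "card ?Z \<le> card Y" using max by blast
    moreover have "u \<notin> Y - {y}" "v \<notin> Y - {y}" using sep uv by blast+
    then have "card ?Z = Suc (Suc (card (Y - {y})))" using uv fY by simp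
    moreover have "Suc (card (Y - {y})) = card Y" using y fY by (meson card_Suc_Diff1)
    ultimately show False by linarith
  qed
  \<comment> \<open>By maximality every neighbour of \<open>x\<close> lies in some star, and one
    outside all private parts lies in two. Summing the overlaps over ordered pairs bounds
    \<open>?B\<close> by \<open>card Y\<close> squared times \<open>mu\<close>, hence by
    \<open>k / 4\<close>.\<close>
  let ?B = "nb x - \<Union>\<K>"
  let ?I = "(Y \<times> Y) - Id"
  have cover: "\<exists>y\<in>Y. w \<in> star x y" if w: "w \<in> nb x" for w
  proof (rule ccontr)
    assume neg: "\<not> ?thesis"
    then have "w \<notin> Y" by (auto simp: star_def)
    have "y \<notin> nb w \<and> w \<notin> nb y" if "y \<in> Y" for y
      using neg that w Y(1) nb_sym[of w y] by (auto simp: star_def nb_iff)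
    then have "?P (insert w Y)" using Y w nb_irrefl by (auto simp: indep_def)
    then have "card (insert w Y) \<le> card Y" by (rule max)
    then show False using \<open>w \<notin> Y\<close> fY by simp
  qed
  have "?B \<subseteq> (\<Union>(y,y')\<in>?I. star x y \<inter> star x y')"
  proof
    fix w assume w: "w \<in> ?B"
    then obtain y where y: "y \<in> Y" "w \<in> star x y" using cover by blast
    with w obtain y' where "y' \<in> Y - {y}" "w \<in> star x y'" by (auto simp: \<K>_def own_def)
    with y show "w \<in> (\<Union>(y,y')\<in>?I. star x y \<inter> star x y')" by fastforce
  qed
  then have "card ?B \<le> card (\<Union>(y,y')\<in>?I. star x y \<inter> star x y')"
    using fY by (intro card_mono) auto
  also have "\<dots> \<le> (\<Sum>(y,y')\<in>?I. card (star x y \<inter> star x y'))"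
    using card_UN_le[of ?I "\<lambda>(y,y'). star x y \<inter> star x y'"] fY by (simp add: case_prod_unfold)
  also have "\<dots> \<le> (\<Sum>(y,y')\<in>?I. mu)"
    using x Y by (intro sum_mono) (auto intro!: card_star_Int simp: indep_def)
  also have "\<dots> = card ?I * mu" by (simp add: case_prod_unfold)
  also have "\<dots> \<le> card (Y \<times> Y) * mu" using fY by (intro mult_le_mono1 card_mono) auto
  also have "\<dots> = card Y * (card Y * mu)" by (simp add: card_cartesian_product)
  finally have "real (card ?B) \<le> real (card Y) * (real (card Y) * mu)"
    by (metis of_nat_le_iff of_nat_mult)
  also have "\<dots> \<le> real (card Y) * (1 / 8 * lam)" by (intro mult_left_mono tmu) auto
  also have "\<dots> \<le> real k / 4" using t' by (simp add: mult.commute)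
  finally have "4 * card ?B \<le> k" by linarith
  then show ?thesis using that[of \<K>] c1 c2 c3 fY by (simp add: \<K>_def)
qed

section \<open>Cliques at nonadjacent vertices\<close>

text \<open>If \<open>u\<close> and \<open>v\<close> lay in both cliques, then \<open>x\<close>,
  \<open>z\<close> and the rest of \<open>K \<union> L\<close> would be common neighbours of the
  adjacent vertices \<open>u\<close>, \<open>v\<close>. So \<open>K \<union> L\<close> has at most
  \<open>lam\<close> vertices, while \<open>K\<close> and \<open>L\<close> have at least
  \<open>7 * lam / 8\<close> each and overlap in at most \<open>mu\<close>, which is less than
  \<open>lam / 16\<close>.\<close>

lemma card_clique_Int:
  assumes x: "x < n" and z: "z \<in> nonnb x" and big: "16 * k * mu < lam\<^sup>2"
    and K: "K \<subseteq> nb x" "7 * lam \<le> 8 * card K" "\<And>u v. u \<in> K \<Longrightarrow> v \<in> K \<Longrightarrow> u \<noteq> v \<Longrightarrow> v \<in> nb u"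
    and L: "L \<subseteq> nb z" "7 * lam \<le> 8 * card L" "\<And>u v. u \<in> L \<Longrightarrow> v \<in> L \<Longrightarrow> u \<noteq> v \<Longrightarrow> v \<in> nb u"
  shows "card (K \<inter> L) \<le> 1"
proof (rule ccontr)
  assume "\<not> ?thesis"
  moreover have fin: "finite K" "finite L" using K L finite_subset[OF _ finite_nb] by auto
  ultimately obtain u v where uv: "u \<in> K \<inter> L" "v \<in> K \<inter> L" "u \<noteq> v"
    by (metis card_le_Suc0_iff_eq finite_Int One_nat_def)
  have zx: "z < n" "z \<noteq> x" "z \<notin> nb x" using z by (auto simp: nonnb_def nb_iff)
  have xz: "x \<notin> nb z" using nb_sym zx by blast
  have xzK: "x \<notin> K \<union> L" "z \<notin> K \<union> L" using K L xz zx nb_irrefl by blast+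
  have un: "u < n" "v < n" using uv K by (auto simp: nb_iff)
  have "k \<noteq> 0" using card_nb[OF x] uv(1) K(1) card_gt_0_iff[of "nb x"] finite_nb by fastforce
  then have kl: "lam < k" using lam_less_k x by blast
  have "insert x (insert z (K \<union> L - {u, v})) \<subseteq> nb u \<inter> nb v"
    using uv K(1,3) L(1,3) nb_sym[OF x] nb_sym[OF zx(1)] by blast
  then have "card (insert x (insert z (K \<union> L - {u, v}))) \<le> card (nb u \<inter> nb v)"
    by (intro card_mono) auto
  moreover have "card (nb u \<inter> nb v) = lam" using card_nb_Int_adj[OF un(1)] K uv by blast
  moreover have "card (insert x (insert z (K \<union> L - {u, v}))) = Suc (Suc (card (K \<union> L - {u, v})))"
    using xzK zx fin by simp
  moreover have "card (K \<union> L - {u, v}) = card (K \<union> L) - 2" using uv fin by (simp add: card_Diff_subset)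
  ultimately have "card (K \<union> L) \<le> lam" by linarith
  moreover have "card K + card L = card (K \<union> L) + card (K \<inter> L)" using fin by (rule card_Un_Int)
  moreover have "card (K \<inter> L) \<le> card (nb x \<inter> nb z)" using K L by (intro card_mono) auto
  moreover have "card (nb x \<inter> nb z) = mu" using card_nb_Int_nonadj x zx by blast
  ultimately have *: "3 * lam \<le> 4 * mu" using K L by linarith
  have "lam * (16 * mu) \<le> 16 * k * mu" using kl by simp
  also have "\<dots> < lam * lam" using big by (simp add: power2_eq_square)
  finally have "16 * mu < lam" by simp
  then show False using * by linarith
qed

text \<open>Otherwise the cliques at nonadjacent \<open>x\<close> and \<open>z\<close> meet in fewer
  than \<open>mu / 2\<close> vertices, so more than half of the common neighbours are missed by the
  cover at \<open>x\<close> or at \<open>z\<close>. Averaged over all such pairs this is too many,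
  since each cover misses at most a quarter of a neighbourhood.\<close>

lemma mu_bound:
  assumes kn: "k + 1 < n" and big: "16 * k * mu < lam\<^sup>2"
  shows "mu * lam\<^sup>2 \<le> 8 * k\<^sup>2"
proof (rule ccontr)
  assume neg: "\<not> ?thesis"
  let ?Q = "\<lambda>x \<K>. finite \<K> \<and> card \<K> * lam \<le> 2 * k \<and>
    (\<forall>K\<in>\<K>. K \<subseteq> nb x \<and> 7 * lam \<le> 8 * card K) \<and>
    (\<forall>K\<in>\<K>. \<forall>u\<in>K. \<forall>v\<in>K. u \<noteq> v \<longrightarrow> v \<in> nb u) \<and>
    4 * card (nb x - \<Union>\<K>) \<le> k"
  have ex: "\<exists>\<K>. ?Q x \<K>" if "x < n" for x
    by (rule clique_cover[OF that big]) blast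
  define \<K> where "\<K> x = (SOME \<K>. ?Q x \<K>)" for x
  have \<K>: "?Q x (\<K> x)" if "x < n" for x
    unfolding \<K>_def by (rule someI_ex[OF ex[OF that]])
  have fin: "finite (\<K> x)" and few: "card (\<K> x) * lam \<le> 2 * k"
    and rest: "4 * card (nb x - \<Union>(\<K> x)) \<le> k" if "x < n" for x
    using \<K>[OF that] by auto
  have sub: "K \<subseteq> nb x" and large: "7 * lam \<le> 8 * card K" if "x < n" "K \<in> \<K> x" for x K
    using \<K>[OF that(1)] that(2) by auto
  have clique: "v \<in> nb u" if "x < n" "K \<in> \<K> x" "u \<in> K" "v \<in> K" "u \<noteq> v" for x K u v
    using \<K>[OF that(1)] that by blast
  define bad where "bad x = nb x - \<Union>(\<K> x)" for x
  have n: "0 < n" using kn by simp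
  have pair: "mu < 2 * card (nb z \<inter> bad x) + 2 * card (nb x \<inter> bad z)"
    if x: "x < n" and z: "z \<in> nonnb x" for x z
  proof -
    have zn: "z < n" "z \<noteq> x" "z \<notin> nb x" using z by (auto simp: nonnb_def nb_iff)
    \<comment> \<open>The common neighbours covered from both sides; each pair of cliques
      contributes at most one.\<close>
    let ?G = "\<Union>(K,L)\<in>\<K> x \<times> \<K> z. K \<inter> L"
    have finG: "finite (\<K> x \<times> \<K> z)" using fin x zn by auto
    have "card ?G \<le> (\<Sum>(K,L)\<in>\<K> x \<times> \<K> z. card (K \<inter> L))"
      using card_UN_le[OF finG, of "\<lambda>(K,L). K \<inter> L"] unfolding case_prod_unfold .
    also have "\<dots> \<le> (\<Sum>(K,L)\<in>\<K> x \<times> \<K> z. 1)"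
    proof (rule sum_mono, unfold case_prod_unfold)
      fix p assume "p \<in> \<K> x \<times> \<K> z"
      then have p: "fst p \<in> \<K> x" "snd p \<in> \<K> z" by auto
      show "card (fst p \<inter> snd p) \<le> 1"
        by (rule card_clique_Int[OF x z big])
          (rule sub large clique x zn(1) p | assumption)+
    qed
    also have "\<dots> = card (\<K> x) * card (\<K> z)" by (simp add: case_prod_unfold card_cartesian_product)
    finally have G: "card ?G \<le> card (\<K> x) * card (\<K> z)" .
    have "card ?G * lam\<^sup>2 \<le> (card (\<K> x) * lam) * (card (\<K> z) * lam)"
      using mult_le_mono1[OF G, of "lam\<^sup>2"] by (simp add: power2_eq_square ac_simps)
    also have "\<dots> \<le> (2 * k) * (2 * k)" by (intro mult_le_mono few x zn)
    finally have G4: "card ?G * lam\<^sup>2 \<le> 4 * k\<^sup>2" by (simp add: power2_eq_square)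
    have G2: "2 * card ?G < mu"
    proof (rule ccontr)
      assume "\<not> 2 * card ?G < mu"
      then have "mu * lam\<^sup>2 \<le> 2 * card ?G * lam\<^sup>2" by (intro mult_le_mono1) linarith
      then show False using G4 neg by linarith
    qed
    have fG: "finite ?G"
      by (rule finite_subset[of _ "nb x"]) (use sub[OF x] in blast, rule finite_nb)
    have "nb x \<inter> nb z \<subseteq> (nb z \<inter> bad x) \<union> (nb x \<inter> bad z) \<union> ?G"
      by (auto simp: bad_def)
    then have "card (nb x \<inter> nb z) \<le> card ((nb z \<inter> bad x) \<union> (nb x \<inter> bad z) \<union> ?G)"
      by (intro card_mono) (simp_all add: fG)
    also have "\<dots> \<le> card (nb z \<inter> bad x) + card (nb x \<inter> bad z) + card ?G"
      by (meson card_Un_le le_trans add_le_mono1)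
    finally show ?thesis using G2 card_nb_Int_nonadj[of x z] x zn by simp
  qed
  have nonempty: "nonnb x \<noteq> {}" if "x < n" for x
    using card_nonnb[OF that] kn by (metis card.empty diff_diff_left less_numeral_extra(3) zero_less_diff)
  have nn: "z \<in> nonnb x \<longleftrightarrow> x \<in> nonnb z" if "x < n" "z < n" for x z
    using that nb_sym[of x z] nb_sym[of z x] by (auto simp: nonnb_def nb_iff)
  \<comment> \<open>Nonadjacency is symmetric, so exchanging the two summations turns the misses at
    \<open>z\<close> into the misses at \<open>x\<close>.\<close>
  let ?S = "\<Sum>x<n. \<Sum>z\<in>nonnb x. card (nb z \<inter> bad x)"
  have "(\<Sum>x<n. \<Sum>z\<in>nonnb x. card (nb x \<inter> bad z)) =
      (\<Sum>x\<in>{..<n}. \<Sum>z\<in>{z\<in>{..<n}. z \<in> nonnb x}. card (nb x \<inter> bad z))"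
    by (intro sum.cong) (auto simp: nonnb_def)
  also have "\<dots> = (\<Sum>z\<in>{..<n}. \<Sum>x\<in>{x\<in>{..<n}. z \<in> nonnb x}. card (nb x \<inter> bad z))"
    by (rule sum.swap_restrict) auto
  also have "\<dots> = ?S"
    using nn by (intro sum.cong) (auto simp: nonnb_def)
  finally have swap: "(\<Sum>x<n. \<Sum>z\<in>nonnb x. card (nb x \<inter> bad z)) = ?S" .
  \<comment> \<open>The double count is proportional to the size of \<open>B\<close>, so replacing
    \<open>nb x\<close> by at most a quarter of it divides the total by at least 4.\<close>
  have S: "4 * ?S \<le> n * ((n - k - 1) * mu)"
  proof -
    have "4 * (\<Sum>z\<in>nonnb x. card (nb z \<inter> bad x)) \<le> (n - k - 1) * mu" if "x < n" for x
    proof -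
      have "4 * (\<Sum>z\<in>nonnb x. card (nb z \<inter> bad x)) = 4 * card (bad x) * (k - lam - 1)"
        using sum_card_nonnb[OF that, of "bad x"] by (simp add: bad_def)
      also have "\<dots> \<le> k * (k - lam - 1)"
        unfolding bad_def by (intro mult_le_mono1 rest that)
      also have "\<dots> = (n - k - 1) * mu" by (rule parameter_identity[OF n])
      finally show ?thesis .
    qed
    then have "(\<Sum>x<n. 4 * (\<Sum>z\<in>nonnb x. card (nb z \<inter> bad x))) \<le> (\<Sum>x<n. (n - k - 1) * mu)"
      by (intro sum_mono) auto
    then show ?thesis by (simp add: sum_distrib_left)
  qed
  have "n * ((n - k - 1) * mu) = (\<Sum>x<n. \<Sum>z\<in>nonnb x. mu)"
    by (simp add: card_nonnb)
  \<comment> \<open>Strictness needs nonempty index sets; the two bounds on \<open>4 * ?S\<close>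
    would otherwise be compatible.\<close>
  also have "\<dots> < (\<Sum>x<n. \<Sum>z\<in>nonnb x. 2 * card (nb z \<inter> bad x) + 2 * card (nb x \<inter> bad z))"
    using n nonempty by (intro sum_strict_mono pair) auto
  also have "\<dots> = 2 * ?S + 2 * ?S"
    using swap by (simp add: sum.distrib sum_distrib_left[symmetric])
  finally show False using S by linarith
qed

end

section \<open>Eigenvalues and the absolute bound\<close>

text \<open>Gaussian elimination, one equation at a time. The index types are arbitrary, so that
  equations can later be indexed by pairs of coordinates.\<close>

lemma homogeneous_system_nontrivial:
  fixes \<phi> :: "'b \<Rightarrow> 'a \<Rightarrow> real"
  assumes "finite P" "finite I" "card P < card I"
  shows "\<exists>c. (\<exists>i\<in>I. c i \<noteq> 0) \<and> (\<forall>p\<in>P. (\<Sum>i\<in>I. c i * \<phi> p i) = 0)"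
  using assms
proof (induction P arbitrary: I \<phi> rule: finite_induct)
  case empty
  then obtain i where "i \<in> I" by fastforce
  then show ?case by (intro exI[of _ "\<lambda>_. 1"]) auto
next
  case (insert q P)
  show ?case
  proof (cases "\<forall>i\<in>I. \<phi> q i = 0")
    case True
    have "card P < card I" using insert by simp
    then obtain c where "\<exists>i\<in>I. c i \<noteq> 0" "\<forall>p\<in>P. (\<Sum>i\<in>I. c i * \<phi> p i) = 0"
      using insert.IH[OF insert.prems(1), of \<phi>] by blast
    then show ?thesis using True by (intro exI[of _ c]) auto
  next
    case False
    then obtain a where a: "a \<in> I" "\<phi> q a \<noteq> 0" by blast
    let ?J = "I - {a}"
    have "card P < card ?J" using insert a by simp
    then obtain c where c: "\<exists>i\<in>?J. c i \<noteq> 0"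
      "\<forall>p\<in>P. (\<Sum>i\<in>?J. c i * (\<phi> p i - \<phi> p a * \<phi> q i / \<phi> q a)) = 0"
      using insert.IH[of ?J "\<lambda>p i. \<phi> p i - \<phi> p a * \<phi> q i / \<phi> q a"] insert.prems by auto
    \<comment> \<open>The reduced system leaves the pivot coordinate \<open>a\<close> free; it is
      chosen to satisfy equation \<open>q\<close>.\<close>
    define d where "d = (\<lambda>i. if i = a then - (\<Sum>i\<in>?J. c i * \<phi> q i) / \<phi> q a else c i)"
    have split: "(\<Sum>i\<in>I. d i * \<phi> p i) =
        (\<Sum>i\<in>?J. c i * \<phi> p i) - (\<Sum>i\<in>?J. c i * \<phi> q i) / \<phi> q a * \<phi> p a" for p
    proof -
      have "(\<Sum>i\<in>I. d i * \<phi> p i) = d a * \<phi> p a + (\<Sum>i\<in>?J. d i * \<phi> p i)"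
        using a insert.prems by (simp add: sum.remove)
      moreover have "(\<Sum>i\<in>?J. d i * \<phi> p i) = (\<Sum>i\<in>?J. c i * \<phi> p i)"
        by (intro sum.cong) (auto simp: d_def)
      ultimately show ?thesis by (simp add: d_def)
    qed
    have "(\<Sum>i\<in>I. d i * \<phi> p i) = 0" if "p \<in> P" for p
    proof -
      have "(\<Sum>i\<in>?J. c i * (\<phi> p i - \<phi> p a * \<phi> q i / \<phi> q a)) =
          (\<Sum>i\<in>?J. c i * \<phi> p i - c i * \<phi> q i * (\<phi> p a / \<phi> q a))"
        by (intro sum.cong) (auto simp: algebra_simps)
      also have "\<dots> = (\<Sum>i\<in>?J. c i * \<phi> p i) - (\<Sum>i\<in>?J. c i * \<phi> q i) * (\<phi> p a / \<phi> q a)"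
        by (simp add: sum_subtractf sum_distrib_right del: times_divide_eq_right)
      finally show ?thesis using c(2) that split[of p] by simp
    qed
    moreover have "(\<Sum>i\<in>I. d i * \<phi> q i) = 0" using split[of q] a by simp
    moreover have "\<exists>i\<in>I. d i \<noteq> 0" using c(1) by (auto simp: d_def)
    ultimately show ?thesis by auto
  qed
qed

text \<open>Subtracting the projection onto a nonzero column of \<open>M\<close> leaves a matrix with the same
  properties, whose trace is smaller by \<open>\<theta>\<close>.\<close>

lemma projection_gram:
  fixes M :: "nat \<Rightarrow> nat \<Rightarrow> real"
  assumes \<theta>: "\<theta> > 0"
    and sym: "\<And>i j. i < n \<Longrightarrow> j < n \<Longrightarrow> M i j = M j i"
    and sq: "\<And>i j. i < n \<Longrightarrow> j < n \<Longrightarrow> (\<Sum>l<n. M i l * M l j) = \<theta> * M i j"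
  shows "\<exists>f w. (\<forall>i<n. \<forall>j<n. M i j = (\<Sum>p<f. w p i * w p j)) \<and> real f * \<theta> = (\<Sum>i<n. M i i)"
proof -
  \<comment> \<open>\<open>N\<close> is an upper bound for the trace in units of
    \<open>\<theta>\<close>. At \<open>N = 0\<close> the trace would be negative, although every
    diagonal entry is a sum of squares divided by \<open>\<theta>\<close>.\<close>
  have "\<exists>f w. (\<forall>i<n. \<forall>j<n. M i j = (\<Sum>p<f. w p i * w p j)) \<and> real f * \<theta> = (\<Sum>i<n. M i i)"
    if "(\<Sum>i<n. M i i) < real N * \<theta>" for N
    using that sym sq
  proof (induction N arbitrary: M)
    case (0 M)
    have "0 \<le> \<theta> * M i i" if "i < n" for i
    proof -
      have "\<theta> * M i i = (\<Sum>l<n. M i l * M i l)"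
        unfolding 0(3)[OF that that, symmetric] using 0(2)[OF that] by (intro sum.cong refl) auto
      then show ?thesis by (simp add: sum_nonneg)
    qed
    then have "0 \<le> (\<Sum>i<n. M i i)" using \<theta> by (intro sum_nonneg) (simp add: zero_le_mult_iff)
    then show ?case using 0(1) by simp
  next
    case (Suc N M)
    have diag: "\<theta> * M i i = (\<Sum>l<n. M l i * M l i)" if "i < n" for i
      unfolding Suc.prems(3)[OF that that, symmetric] using Suc.prems(2)[OF that]
      by (intro sum.cong refl) auto
    show ?case
    proof (cases "\<forall>i<n. M i i = 0")
      case True
      have "M j i = 0" if "i < n" "j < n" for i j
      proof -
        have "(\<Sum>l<n. M l i * M l i) = 0" using diag[OF that(1)] True that by simp
        then show ?thesis using that by (subst (asm) sum_nonneg_eq_0_iff) auto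
      qed
      then show ?thesis using True by (intro exI[of _ 0]) auto
    next
      case False
      then obtain a where a: "a < n" "M a a \<noteq> 0" by blast
      have "0 \<le> \<theta> * M a a" unfolding diag[OF a(1)] by (simp add: sum_nonneg)
      then have pos: "M a a > 0" using a \<theta> by (simp add: zero_le_mult_iff)
      define M' where "M' i j = M i j - M i a * M j a / M a a" for i j
      have col: "(\<Sum>l<n. M i l * M l a) = \<theta> * M i a" if "i < n" for i
        using Suc.prems(3) that a by blast
      have col': "(\<Sum>l<n. M l a * M l j) = \<theta> * M j a" if "j < n" for j
        unfolding col[OF that, symmetric] using Suc.prems(2)[OF that] by (intro sum.cong refl) auto
      have sq': "(\<Sum>l<n. M' i l * M' l j) = \<theta> * M' i j" if "i < n" "j < n" for i j
      proof -
        have "(\<Sum>l<n. M' i l * M' l j) = (\<Sum>l<n. M i l * M l j - M i l * M l a * (M j a / M a a)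
           - M l a * M l j * (M i a / M a a) + M l a * M l a * (M i a * M j a / (M a a * M a a)))"
          by (intro sum.cong) (auto simp: M'_def field_simps a)
        also have "\<dots> = \<theta> * M i j - \<theta> * M i a * (M j a / M a a) - \<theta> * M j a * (M i a / M a a)
           + \<theta> * M a a * (M i a * M j a / (M a a * M a a))"
          using Suc.prems(3)[OF that] col[OF that(1)] col'[OF that(2)] diag[OF a(1)]
          by (simp only: sum.distrib sum_subtractf sum_distrib_right[symmetric])
        also have "\<dots> = \<theta> * M' i j" using a by (simp add: M'_def field_simps)
        finally show ?thesis .
      qed
      have "(\<Sum>i<n. M' i i) = (\<Sum>i<n. M i i) - (\<Sum>i<n. M i a * M i a) / M a a"
        by (simp add: M'_def sum_subtractf sum_divide_distrib)
      then have tr: "(\<Sum>i<n. M' i i) = (\<Sum>i<n. M i i) - \<theta>"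
        unfolding diag[OF a(1), symmetric] using a by simp
      have "(\<Sum>i<n. M' i i) < real N * \<theta>" using tr Suc.prems(1) by (simp add: algebra_simps)
      moreover have "M' i j = M' j i" if "i < n" "j < n" for i j
        using Suc.prems(2)[OF that] by (simp add: M'_def)
      ultimately obtain f w where fw: "\<forall>i<n. \<forall>j<n. M' i j = (\<Sum>p<f. w p i * w p j)"
        "real f * \<theta> = (\<Sum>i<n. M' i i)"
        using Suc.IH[of M'] sq' by blast
      \<comment> \<open>The removed projection is restored by the column \<open>a\<close>, scaled by
        the square root of its diagonal entry.\<close>
      define w' where "w' = w(f := (\<lambda>i. M i a / sqrt (M a a)))"
      have "M i j = (\<Sum>p<Suc f. w' p i * w' p j)" if "i < n" "j < n" for i j
      proof -
        have "(\<Sum>p<f. w' p i * w' p j) = M' i j" using fw(1) that by (simp add: w'_def)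
        then show ?thesis using pos by (simp add: w'_def M'_def)
      qed
      moreover have "real (Suc f) * \<theta> = (\<Sum>i<n. M i i)"
        using fw(2) tr by (simp add: algebra_simps)
      ultimately show ?thesis by blast
    qed
  qed
  moreover obtain N where "(\<Sum>i<n. M i i) < real N * \<theta>"
    using reals_Archimedean3[OF \<theta>] by blast
  ultimately show ?thesis by blast
qed

text \<open>Each factor \<open>M i j - b\<close>, \<open>M i j - c\<close> is a bilinear form in
  \<open>f + 1\<close> coordinates, so their entrywise product has rank at most
  \<open>(f + 1)\<^sup>2\<close>. This product is a nonzero multiple of the identity.\<close>

lemma two_distance_bound:
  fixes w :: "nat \<Rightarrow> nat \<Rightarrow> real" and M :: "nat \<Rightarrow> nat \<Rightarrow> real"
  assumes M: "\<And>i j. i < n \<Longrightarrow> j < n \<Longrightarrow> M i j = (\<Sum>p<f. w p i * w p j)"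
    and diag: "\<And>i. i < n \<Longrightarrow> M i i = a"
    and off: "\<And>i j. i < n \<Longrightarrow> j < n \<Longrightarrow> i \<noteq> j \<Longrightarrow> M i j = b \<or> M i j = c"
    and ne: "a \<noteq> b" "a \<noteq> c"
  shows "n \<le> (f + 1)\<^sup>2"
proof (rule ccontr)
  assume "\<not> ?thesis"
  then have "card ({..f} \<times> {..f}) < card {..<n}"
    by (simp add: card_cartesian_product power2_eq_square)
  \<comment> \<open>The additional coordinate \<open>f\<close> is constantly 1, and its weight
    \<open>- x\<close> in \<open>e\<close> produces the shift.\<close>
  define W where "W p i = (if p < f then w p i else 1)" for p i
  define e where "e x p = (if p < f then 1 else - x)" for x :: real and p
  have exp: "M i j - x = (\<Sum>p\<le>f. e x p * W p i * W p j)" if "i < n" "j < n" for i j x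
    using M[OF that] by (simp add: W_def e_def lessThan_Suc_atMost[symmetric])
  obtain g where g: "\<exists>i\<in>{..<n}. g i \<noteq> 0"
    "\<forall>p\<in>{..f} \<times> {..f}. (\<Sum>i<n. g i * (W (fst p) i * W (snd p) i)) = 0"
    using homogeneous_system_nontrivial[of "{..f} \<times> {..f}" "{..<n}"
        "\<lambda>p i. W (fst p) i * W (snd p) i"] \<open>card _ < card _\<close> by auto
  have "g j = 0" if j: "j < n" for j
  proof -
    have "(\<Sum>i<n. g i * ((M i j - b) * (M i j - c))) = (\<Sum>i<n. if i = j then g j * ((a - b) * (a - c)) else 0)"
      using off j diag by (intro sum.cong) auto
    then have "g j * ((a - b) * (a - c)) = (\<Sum>i<n. g i * ((M i j - b) * (M i j - c)))"
      using j by simp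
    also have "\<dots> = (\<Sum>i<n. \<Sum>p\<le>f. \<Sum>q\<le>f. g i * (W p i * W q i) * (e b p * e c q * W p j * W q j))"
    proof (intro sum.cong refl)
      fix i assume "i \<in> {..<n}"
      then have i: "i < n" by simp
      show "g i * ((M i j - b) * (M i j - c)) =
          (\<Sum>p\<le>f. \<Sum>q\<le>f. g i * (W p i * W q i) * (e b p * e c q * W p j * W q j))"
        unfolding exp[OF i j] unfolding sum_product unfolding sum_distrib_left
        by (intro sum.cong refl) (simp only: ac_simps)
    qed
    \<comment> \<open>Once the sum over \<open>i\<close> is innermost, it vanishes by the choice of
      \<open>g\<close>.\<close>
    also have "\<dots> = (\<Sum>p\<le>f. \<Sum>i<n. \<Sum>q\<le>f. g i * (W p i * W q i) * (e b p * e c q * W p j * W q j))"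
      by (rule sum.swap)
    also have "\<dots> = (\<Sum>p\<le>f. \<Sum>q\<le>f. \<Sum>i<n. g i * (W p i * W q i) * (e b p * e c q * W p j * W q j))"
      by (rule sum.cong[OF refl], rule sum.swap)
    also have "\<dots> = 0"
      using g(2) by (simp add: sum_distrib_right[symmetric])
    finally show ?thesis using ne by simp
  qed
  then show False using g(1) by auto
qed

section \<open>Spectrum of the adjacency matrix\<close>

context srg
begin

definition adj :: "nat \<Rightarrow> nat \<Rightarrow> real" where
  "adj i j = of_bool (E i j)"

text \<open>Replaces matrices and vectors by functions on indices, so that the spectral arguments
  are computations with finite sums.\<close>

lemma eigenvalue_adj_iff:
  "eigenvalue (adj_mat n E) \<theta> \<longleftrightarrow>
    (\<exists>v. (\<exists>i<n. v i \<noteq> 0) \<and> (\<forall>i<n. (\<Sum>j<n. adj i j * v j) = \<theta> * v i))"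
proof
  assume "eigenvalue (adj_mat n E) \<theta>"
  then obtain v where v: "v \<in> carrier_vec n" "v \<noteq> 0\<^sub>v n" "adj_mat n E *\<^sub>v v = \<theta> \<cdot>\<^sub>v v"
    by (auto simp: eigenvalue_def eigenvector_def adj_mat_def)
  have "(\<Sum>j<n. adj i j * v $ j) = \<theta> * v $ i" if "i < n" for i
  proof -
    have "(adj_mat n E *\<^sub>v v) $ i = (\<Sum>j<n. adj i j * v $ j)"
      using that v(1) by (simp add: adj_mat_def scalar_prod_def adj_def atLeast0LessThan of_bool_def)
    then show ?thesis using v that by simp
  qed
  moreover have "\<exists>i<n. v $ i \<noteq> 0" using v(1,2) by (metis carrier_vecD eq_vecI index_zero_vec)
  ultimately show "\<exists>v. (\<exists>i<n. v i \<noteq> 0) \<and> (\<forall>i<n. (\<Sum>j<n. adj i j * v j) = \<theta> * v i)" by auto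
next
  assume "\<exists>v. (\<exists>i<n. v i \<noteq> 0) \<and> (\<forall>i<n. (\<Sum>j<n. adj i j * v j) = \<theta> * v i)"
  then obtain v i where v: "i < n" "v i \<noteq> 0" "\<And>i. i < n \<Longrightarrow> (\<Sum>j<n. adj i j * v j) = \<theta> * v i" by blast
  have "adj_mat n E *\<^sub>v vec n v = \<theta> \<cdot>\<^sub>v vec n v"
  proof (rule eq_vecI)
    fix i assume "i < dim_vec (\<theta> \<cdot>\<^sub>v vec n v)"
    then have i: "i < n" by simp
    have "(adj_mat n E *\<^sub>v vec n v) $ i = (\<Sum>j<n. adj i j * v j)"
      using i by (simp add: adj_mat_def scalar_prod_def adj_def atLeast0LessThan of_bool_def)
    then show "(adj_mat n E *\<^sub>v vec n v) $ i = (\<theta> \<cdot>\<^sub>v vec n v) $ i" using v(3)[OF i] i by simp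
  qed (simp add: adj_mat_def)
  moreover have "vec n v \<noteq> 0\<^sub>v n" using v(1,2) by (metis index_vec index_zero_vec(1))
  ultimately show "eigenvalue (adj_mat n E) \<theta>"
    unfolding eigenvalue_def eigenvector_def by (intro exI[of _ "vec n v"]) (simp add: adj_mat_def)
qed

lemma adj_sym: "i < n \<Longrightarrow> j < n \<Longrightarrow> adj i j = adj j i"
  using edge_sym[of i j] edge_sym[of j i] by (auto simp: adj_def)

lemma sum_adj:
  assumes "i < n"
  shows "(\<Sum>j<n. adj i j) = k"
proof -
  have "(\<Sum>j<n. adj i j) = card ({..<n} \<inter> {j. E i j})"
    by (simp add: adj_def)
  also have "{..<n} \<inter> {j. E i j} = nb i" by (auto simp: nb_def)
  finally show ?thesis using card_nb[OF assms] by simp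
qed

text \<open>The entry counts common neighbours; the right-hand side interpolates the values
  \<open>k\<close>, \<open>lam\<close> and \<open>mu\<close> for equal, adjacent and nonadjacent
  indices.\<close>

lemma adj_square:
  assumes i: "i < n" and l: "l < n"
  shows "(\<Sum>j<n. adj i j * adj j l) =
    real mu + (real lam - real mu) * adj i l + (real k - real mu) * of_bool (i = l)"
proof -
  have "(\<Sum>j<n. adj i j * adj j l) = (\<Sum>j<n. of_bool (E i j \<and> E l j))"
    using edge_sym l by (intro sum.cong refl) (auto simp: adj_def)
  also have "\<dots> = card ({..<n} \<inter> {j. E i j \<and> E l j})" by simp
  also have "{..<n} \<inter> {j. E i j \<and> E l j} = nb i \<inter> nb l" by (auto simp: nb_def)
  finally show ?thesis
    using card_nb[OF i] card_nb_Int_adj[OF i] card_nb_Int_nonadj[OF i l] nb_irrefl[of i] l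
    by (cases "i = l"; cases "E i l") (auto simp: adj_def nb_iff)
qed

text \<open>All column sums are \<open>k\<close>, so an eigenvector for another eigenvalue has
  coordinate sum 0 and the constant term of \<open>adj_square\<close> drops out.\<close>

lemma eigenvalue_quadratic:
  assumes ev: "eigenvalue (adj_mat n E) \<theta>" and ne: "\<theta> \<noteq> k"
  shows "\<theta>\<^sup>2 = (real lam - real mu) * \<theta> + (real k - real mu)"
proof -
  obtain v i where v: "i < n" "v i \<noteq> 0" "\<And>i. i < n \<Longrightarrow> (\<Sum>j<n. adj i j * v j) = \<theta> * v i"
    using ev unfolding eigenvalue_adj_iff by blast
  have "\<theta> * (\<Sum>i<n. v i) = (\<Sum>i<n. \<Sum>j<n. adj i j * v j)"
    by (simp add: v(3) sum_distrib_left)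
  also have "\<dots> = (\<Sum>j<n. \<Sum>i<n. adj j i * v j)"
    by (subst sum.swap) (intro sum.cong refl, auto simp: adj_sym)
  also have "\<dots> = k * (\<Sum>i<n. v i)"
    by (simp add: sum_distrib_right[symmetric] sum_adj sum_distrib_left)
  finally have sum0: "(\<Sum>i<n. v i) = 0" using ne by simp
  have "\<theta> * (\<theta> * v i) = (\<Sum>j<n. adj i j * (\<theta> * v j))"
    unfolding v(3)[OF v(1), symmetric] sum_distrib_left by (intro sum.cong) auto
  also have "\<dots> = (\<Sum>j<n. \<Sum>l<n. adj i j * (adj j l * v l))"
    by (simp add: v(3)[symmetric] sum_distrib_left)
  also have "\<dots> = (\<Sum>l<n. (\<Sum>j<n. adj i j * adj j l) * v l)"
    by (subst sum.swap) (simp only: sum_distrib_right mult.assoc)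
  also have "\<dots> = (\<Sum>l<n. mu * v l + (real lam - mu) * (adj i l * v l) + (if l = i then (real k - mu) * v l else 0))"
    by (intro sum.cong refl) (auto simp: adj_square[OF v(1)] distrib_right mult.assoc)
  also have "\<dots> = mu * (\<Sum>l<n. v l) + (real lam - mu) * (\<theta> * v i) + (real k - mu) * v i"
    using v(1) by (simp add: sum.distrib sum_distrib_left[symmetric] v(3))
  finally have "(\<theta>\<^sup>2 - ((real lam - mu) * \<theta> + (real k - mu))) * v i = 0"
    using sum0 by (simp add: algebra_simps power2_eq_square)
  then show ?thesis using v(2) by simp
qed

lemma parameter_identity_real:
  assumes "0 < k" "k < n"
  shows "real k * (real k - real lam - 1) = (real n - real k - 1) * real mu"
proof -
  have n: "0 < n" using assms by simp
  have "lam < k" using lam_less_k[OF n assms(1)] .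
  then have "real (k - lam - 1) = real k - real lam - 1" "real (n - k - 1) = real n - real k - 1"
    using assms by auto
  then show ?thesis using parameter_identity[OF n] by (metis of_nat_mult)
qed

text \<open>For a root \<open>s\<close> of the quadratic, \<open>proj s\<close> is a multiple of the orthogonal projection
  onto the eigenspace of the \<^emph>\<open>other\<close> root.\<close>

definition proj :: "real \<Rightarrow> nat \<Rightarrow> nat \<Rightarrow> real" where
  "proj s i j = adj i j - s * of_bool (i = j) - (real k - s) / real n"

lemma adj_proj:
  assumes kn: "0 < k" "k < n"
    and s: "s\<^sup>2 = (real lam - real mu) * s + (real k - real mu)"
    and i: "i < n" and l: "l < n"
  shows "(\<Sum>j<n. adj i j * proj s j l) = (real lam - real mu - s) * proj s i l"
proof -
  let ?r = "real lam - real mu - s"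
  define D where "D = (real k - s) / real n"
  have "(\<Sum>j<n. adj i j * proj s j l) =
     (\<Sum>j<n. adj i j * adj j l - (if j = l then s * adj i j else 0) - adj i j * D)"
    by (intro sum.cong refl) (auto simp: proj_def D_def right_diff_distrib)
  also have "\<dots> = (mu + (real lam - mu) * adj i l + (real k - mu) * of_bool (i = l)) - s * adj i l - k * D"
    using l by (simp add: sum_subtractf adj_square i sum_distrib_right[symmetric] sum_adj)
  also have "\<dots> = ?r * proj s i l"
  proof -
    \<comment> \<open>\<open>?r\<close> is the second root of the quadratic. This identity, the
      parameter identity in factored form, makes the constant terms match.\<close>
    have "real n * mu = (real k - s) * (real k - ?r)"
      using parameter_identity_real[OF kn] s by (simp add: algebra_simps power2_eq_square)
    then have 1: "real mu = D * (real k - ?r)" using kn by (simp add: D_def field_simps)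
    have 2: "real k - mu = - ?r * s" using s by (simp add: algebra_simps power2_eq_square)
    have "real mu + (real lam - mu) * x + - ?r * s * y - s * x - k * D = ?r * (x - s * y - D)" for x y
      using 1 by (simp add: algebra_simps)
    then show ?thesis unfolding proj_def 2 D_def[symmetric] by blast
  qed
  finally show ?thesis .
qed

lemma proj_sym: "i < n \<Longrightarrow> j < n \<Longrightarrow> proj s i j = proj s j i"
  using adj_sym[of i j] by (auto simp: proj_def)

text \<open>The constant \<open>(k - s) / n\<close> in \<open>proj\<close> is chosen to cancel the
  column sum \<open>k - s\<close> of the remaining terms.\<close>

lemma sum_proj:
  assumes "l < n"
  shows "(\<Sum>j<n. proj s j l) = 0"
proof -
  have "(\<Sum>j<n. proj s j l) = (\<Sum>j<n. adj l j - (if j = l then s else 0) - (real k - s) / real n)"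
    using assms by (intro sum.cong refl) (auto simp: proj_def adj_sym)
  then show ?thesis using assms sum_adj[OF assms] by (simp add: sum_subtractf)
qed

lemma proj_square:
  assumes kn: "0 < k" "k < n"
    and s: "s\<^sup>2 = (real lam - real mu) * s + (real k - real mu)"
    and i: "i < n" and l: "l < n"
  shows "(\<Sum>j<n. proj s i j * proj s j l) = (real lam - real mu - 2 * s) * proj s i l"
proof -
  have "(\<Sum>j<n. proj s i j * proj s j l) =
     (\<Sum>j<n. adj i j * proj s j l - (if j = i then s * proj s j l else 0) - (real k - s) / real n * proj s j l)"
    by (intro sum.cong refl) (auto simp: proj_def[of s i] left_diff_distrib)
  also have "\<dots> = (real lam - mu - s) * proj s i l - s * proj s i l"
    using i l by (simp add: sum_subtractf adj_proj[OF kn s] sum_distrib_left[symmetric] sum_proj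
        del: times_divide_eq_left)
  finally show ?thesis by (simp add: algebra_simps)
qed

text \<open>The predicate \<open>srg_eigenvalues\<close> allows \<open>r = k\<close>, so
  \<open>r\<close> has to be identified with the second root. That root is an eigenvalue, with a
  column of \<open>proj s\<close> as eigenvector, and cannot equal \<open>k\<close> or
  \<open>s\<close>. The condition on \<open>s\<close> excludes \<open>mu = 0\<close>, where the
  quadratic is \<open>(s + 1) * (s - k)\<close>.\<close>

lemma srg_eigenvalues_vieta:
  assumes kn: "2 * real k \<le> real n - 1" and ev: "srg_eigenvalues n E k r s"
    and s1: "s \<noteq> -1"
  shows "0 < k" "r + s = real lam - real mu" "r * s = real mu - real k" "0 < mu"
proof -
  have evs: "eigenvalue (adj_mat n E) r" "eigenvalue (adj_mat n E) s" "r \<le> k" "s < r"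
    "\<And>x. eigenvalue (adj_mat n E) x \<Longrightarrow> x = k \<or> x = r \<or> x = s"
    using ev by (auto simp: srg_eigenvalues_def)
  have kn': "k < n" using kn by linarith
  show k0: "0 < k"
  proof (rule ccontr)
    assume "\<not> 0 < k"
    then have "nb i = {}" if "i < n" for i using card_nb[OF that] by simp
    then have z: "adj i j = 0" if "i < n" "j < n" for i j
      using that by (auto simp: adj_def nb_def)
    have "x = 0" if x: "eigenvalue (adj_mat n E) x" for x
      using x unfolding eigenvalue_adj_iff by (auto simp: z)
    then have "r = 0" "s = 0" using evs(1,2) by blast+
    then show False using evs(4) by simp
  qed
  have q: "s\<^sup>2 = (real lam - real mu) * s + (real k - real mu)"
    by (rule eigenvalue_quadratic) (use evs(2,3,4) in auto)
  let ?r = "real lam - real mu - s"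
  note id = parameter_identity_real[OF k0 kn']
  have mu0: "mu \<noteq> 0"
  proof
    assume mu: "mu = 0"
    then have lam: "real lam = real k - 1" using id k0 by simp
    have "s\<^sup>2 = (real k - 1) * s + real k" using q unfolding lam mu by simp
    moreover have "(s + 1) * (s - real k) = s\<^sup>2 - ((real k - 1) * s + real k)"
      by (simp add: algebra_simps power2_eq_square)
    ultimately have "(s + 1) * (s - real k) = 0" by simp
    then show False using evs(3,4) s1 by auto
  qed
  then show "0 < mu" by simp
  have "eigenvalue (adj_mat n E) ?r"
  proof -
    have "card (nonnb 0) = n - k - 1" using card_nonnb kn' by simp
    then have "card (nonnb 0) > 0" using kn k0 by linarith
    then obtain j where j: "j < n" "j \<noteq> 0" "\<not> E 0 j" by (auto simp: card_gt_0_iff nonnb_def)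
    \<comment> \<open>A nonneighbour \<open>j\<close> of 0 gives the entry
      \<open>- (k - s) / n\<close>.\<close>
    have "proj s 0 j \<noteq> 0" using j evs(3,4) kn' by (simp add: proj_def adj_def)
    moreover have "0 < n" using kn' by simp
    ultimately have "\<exists>i<n. proj s i j \<noteq> 0" by blast
    then show ?thesis
      unfolding eigenvalue_adj_iff using adj_proj[OF k0 kn' q _ j(1)]
      by (intro exI[of _ "\<lambda>i. proj s i j"]) auto
  qed
  then consider "?r = k" | "?r = s" | "?r = r" using evs(5) by blast
  then have "?r = r"
  proof cases
    case 1
    have "real n * mu = (real k - s) * (real k - ?r)"
      using id q by (simp add: algebra_simps power2_eq_square)
    then show ?thesis using 1 kn' mu0 by simp
  next
    case 2
    have "s\<^sup>2 + (real k - mu) = 0" using 2 q by (simp add: algebra_simps power2_eq_square)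
    moreover have "0 \<le> s\<^sup>2" by simp
    ultimately have km: "real k \<le> mu" by linarith
    have "real k * real k \<le> (real n - real k - 1) * mu" using km kn by (intro mult_mono) auto
    also have "\<dots> = real k * (real k - real lam - 1)" using id by simp
    finally show ?thesis using k0 by simp
  qed simp
  then show "r + s = real lam - real mu" by simp
  then show "r * s = real mu - real k"
    using q by (simp add: algebra_simps power2_eq_square \<open>?r = r\<close>[symmetric])
qed

end

section \<open>The absolute bound\<close>

context srg
begin

lemma absolute_bound:
  assumes kn: "0 < k" "k < n"
    and vieta: "r + s = real lam - real mu" "r * s = real mu - real k"
    and r: "0 < r" and s: "s < -1"
  shows "r \<le> 2 * (- s) * sqrt n"
proof -
  have q: "s\<^sup>2 = (real lam - real mu) * s + (real k - real mu)"
    using vieta(2) unfolding vieta(1)[symmetric] by (simp add: algebra_simps power2_eq_square)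
  have \<theta>: "real lam - real mu - 2 * s = r - s" using vieta(1) by simp
  have "0 < r - s" using r s by simp
  then obtain f w where fw: "\<forall>i<n. \<forall>j<n. proj s i j = (\<Sum>p<f. w p i * w p j)"
    "real f * (r - s) = (\<Sum>i<n. proj s i i)"
    using projection_gram[of "r - s" n "proj s"] proj_sym proj_square[OF kn q] unfolding \<theta> by blast
  \<comment> \<open>All entries are shifted by the same \<open>D\<close>, so the diagonal value
    stays apart from the other two because \<open>s < -1\<close>.\<close>
  define D where "D = (real k - s) / n"
  have diag: "proj s i i = - s - D" if "i < n" for i
    using that nb_irrefl[of i] by (simp add: proj_def adj_def D_def nb_iff)
  have "n \<le> (f + 1)\<^sup>2"
  proof (rule two_distance_bound[where M = "proj s" and w = w and a = "- s - D" and b = "1 - D" and c = "- D"])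
    show "proj s i j = 1 - D \<or> proj s i j = - D" if "i \<noteq> j" for i j
      using that by (simp add: proj_def adj_def D_def)
  qed (use fw diag s in auto)
  then have nf: "real n \<le> (real f + 1)\<^sup>2" by (simp flip: of_nat_le_iff of_nat_Suc add: add.commute)
  \<comment> \<open>Allows \<open>f + 1\<close> to be replaced by \<open>2 * f\<close>.\<close>
  have "f \<noteq> 0"
  proof
    assume "f = 0"
    then show False using nf kn by simp
  qed
  then have "(real f + 1)\<^sup>2 \<le> (2 * real f)\<^sup>2" by (intro power_mono) auto
  then have "sqrt n \<le> 2 * real f" using nf by (intro real_le_lsqrt) auto
  then have "r * sqrt n \<le> r * (2 * real f)" using r by simp
  also have "\<dots> \<le> 2 * (real f * (r - s))" using s by (simp add: algebra_simps mult_nonneg_nonpos2)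
  also have "real f * (r - s) = n * (- s - D)" using fw(2) diag by simp
  also have "\<dots> \<le> n * (- s)" using s by (intro mult_left_mono) (auto simp: D_def)
  finally have "r * sqrt n \<le> 2 * (- s) * (sqrt n * sqrt n)" by (simp add: ac_simps)
  then have "r * sqrt n \<le> 2 * (- s) * sqrt n * sqrt n" by (simp only: mult.assoc)
  then show ?thesis by (rule mult_right_le_imp_le) (use kn in simp)
qed

end

section \<open>The three estimates for \<open>h_fun\<close>\<close>

lemma power_le_imp_le_powr:
  fixes x y :: real
  assumes "x ^ q \<le> y powr p" "0 < q" "0 \<le> y"
  shows "x \<le> y powr (p / real q)"
proof (rule power_le_imp_le_base[of _ "q - 1"])
  have "(y powr (p / real q)) ^ q = y powr p"
    using assms(2,3) by (cases "y = 0") (simp_all add: powr_realpow[symmetric] powr_powr)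
  then show "x ^ Suc (q - 1) \<le> (y powr (p / real q)) ^ Suc (q - 1)"
    using assms by simp
qed simp

lemma le_h_funI:
  fixes \<kappa> x :: real
  assumes \<kappa>: "\<kappa> = real k / real n"
    and "x \<le> c * \<kappa> powr (4/3)"
    and "x \<le> c * max (real k powr (1/2) / real n powr (3/4)) (\<kappa> powr 2)"
    and "x \<le> c * max (\<kappa> powr (3/2)) ((1 / real n) powr (1/2))"
  shows "x \<le> c * h_fun n k"
  using assms by (auto simp: h_fun_def min_def)

context srg
begin

lemma claw_bound_lambda:
  assumes kn: "2 * real k \<le> real n - 1" and ev: "srg_eigenvalues n E k r s"
    and claw: "r \<le> max (2 * (- s - 1) * (real mu + 1 + s) + s) (s * (s + 1) * (real mu + 1) / 2 - 1)"
  shows "real lam / real n \<le> 125 * h_fun n k"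
proof -
  have rs: "s < r" using ev by (simp add: srg_eigenvalues_def)
  \<comment> \<open>At \<open>s = -1\<close> both sides of the maximum are -1, which contradicts
    \<open>s < r\<close>.\<close>
  have "s \<noteq> -1" using claw rs by auto
  note v = srg_eigenvalues_vieta[OF kn ev this]
  define m where "m = - s"
  have kn': "k < n" using kn by linarith
  have n3: "real n \<ge> 3" using kn v(1) by linarith
  note id = parameter_identity_real[OF v(1) kn']
  have lk: "real lam + 1 \<le> real k" using lam_less_k[of 0] v(1) kn' by simp
  have mu1: "1 \<le> real mu" using v(4) by linarith
  have "real k * (real k - real lam - 1) < (real n - real k - 1) * real k"
    using v(1) kn lk by (subst mult.commute, intro mult_strict_right_mono) auto
  then have muk: "real mu < real k" unfolding id using kn v(1) by simp
  have "r * s < 0" using v(3) muk by simp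
  then have r0: "0 < r" and s0: "s < 0" using rs by (auto simp: mult_less_0_iff)
  \<comment> \<open>By the sum and product of the roots, this product is
    \<open>lam + 1 - k\<close>.\<close>
  have "(r + 1) * (s + 1) \<le> 0" using v(2,3) lk by (simp add: algebra_simps)
  then have "s \<le> -1" using r0 by (simp add: mult_le_0_iff)
  then have m1: "1 < m" using \<open>s \<noteq> -1\<close> by (simp add: m_def)
  have rm: "r * m \<le> real k" using v(3) by (simp add: m_def)
  have muk2: "real mu \<le> 4 * real k ^ 2 / real n"
  proof -
    have "real n / 4 * mu \<le> (real n - real k - 1) * real mu"
      using kn n3 by (intro mult_right_mono) auto
    also have "\<dots> \<le> real k * real k" unfolding id[symmetric] by (intro mult_left_mono) auto
    finally show ?thesis using n3 by (simp add: field_simps power2_eq_square)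
  qed
  have lr: "real lam \<le> real mu + r" using v(2) s0 by linarith
  define \<kappa> where "\<kappa> = real k / real n"
  have \<kappa>0: "0 < \<kappa>" and \<kappa>1: "\<kappa> < 1" using v(1) kn' by (auto simp: \<kappa>_def)
  have mun: "real mu / n \<le> 4 * \<kappa> powr 2"
    using muk2 n3 \<kappa>0 by (simp add: \<kappa>_def field_simps power2_eq_square)
  \<comment> \<open>Both alternatives of the claw bound obey this estimate; the second one uses
    \<open>(mu + 1) / 2 \<le> mu\<close>.\<close>
  have "r \<le> 2 * m\<^sup>2 * mu"
  proof -
    have "2 * (- s - 1) * (real mu + 1 + s) + s \<le> 2 * (m - 1) * real mu"
    proof -
      have "2 * (m - 1) * (real mu + 1 - m) \<le> 2 * (m - 1) * real mu"
        using m1 by (intro mult_left_mono) auto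
      then show ?thesis using s0 by (simp add: m_def)
    qed
    also have "\<dots> \<le> 2 * m\<^sup>2 * mu"
    proof -
      have "m - 1 \<le> m\<^sup>2" using m1 self_le_power[of m 2] by simp
      then show ?thesis by (intro mult_right_mono) auto
    qed
    finally have 1: "2 * (- s - 1) * (real mu + 1 + s) + s \<le> 2 * m\<^sup>2 * mu" .
    have "s * (s + 1) * (real mu + 1) / 2 - 1 \<le> (m * (m - 1)) * ((real mu + 1) / 2)"
      by (simp add: m_def algebra_simps)
    also have "\<dots> \<le> m\<^sup>2 * real mu"
      using m1 mu1 by (intro mult_mono) (auto simp: power2_eq_square)
    also have "\<dots> \<le> 2 * m\<^sup>2 * mu" by simp
    finally show ?thesis using claw 1 by simp
  qed
  then have "r ^ 3 \<le> r\<^sup>2 * (2 * m\<^sup>2 * mu)"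
    by (simp add: power3_eq_cube power2_eq_square mult_left_mono)
  also have "\<dots> = 2 * (r * m)\<^sup>2 * mu" by (simp add: power_mult_distrib)
  also have "\<dots> \<le> 2 * (real k)\<^sup>2 * (4 * real k ^ 2 / real n)"
    using rm r0 m1 muk2 by (intro mult_mono power_mono) auto
  finally have r3: "r ^ 3 \<le> 8 * real k ^ 4 / real n" by (simp add: power2_eq_square power4_eq_xxxx)
  have "(r / (2 * n)) ^ 3 = r ^ 3 / (8 * real n ^ 3)" by (simp add: power_divide power_mult_distrib)
  also have "\<dots> \<le> (8 * real k ^ 4 / real n) / (8 * real n ^ 3)"
    using r3 by (intro divide_right_mono) auto
  also have "\<dots> = \<kappa> powr 4"
    using \<kappa>0 n3 by (simp add: \<kappa>_def power_divide power4_eq_xxxx power3_eq_cube)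
  finally have "r / (2 * n) \<le> \<kappa> powr (4 / real 3)"
    using \<kappa>0 by (intro power_le_imp_le_powr) auto
  then have rn: "r / n \<le> 2 * \<kappa> powr (4/3)" by (simp add: field_simps)
  have "\<kappa> powr 2 \<le> \<kappa> powr (4/3)" using \<kappa>0 \<kappa>1 by (intro powr_mono') auto
  moreover have lrn: "real lam / n \<le> real mu / n + r / n"
    using divide_right_mono[OF lr, of n] by (simp add: add_divide_distrib)
  ultimately have b1: "real lam / n \<le> 6 * \<kappa> powr (4/3)" using mun rn by linarith

  have "r \<le> 2 * m * sqrt n"
    using absolute_bound[OF v(1) kn' v(2,3) r0] m1 by (simp add: m_def)
  then have "r\<^sup>2 \<le> r * (2 * m * sqrt n)"
    using r0 by (simp only: power2_eq_square mult_left_mono less_imp_le)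
  also have "\<dots> = 2 * sqrt n * (r * m)" by simp
  also have "\<dots> \<le> 2 * sqrt n * k" using rm by (intro mult_left_mono) auto
  finally have r2: "r\<^sup>2 \<le> 2 * sqrt n * k" .
  let ?h = "real k powr (1/2) / real n powr (3/4)"
  \<comment> \<open>The factor 2 in \<open>r2\<close> is relaxed to 4, a perfect square.\<close>
  have "(2 * (real k powr (1/2) * real n powr (1/4)))\<^sup>2 = 4 * sqrt n * k"
    using v(1) n3
    by (simp add: power_mult_distrib powr_realpow[symmetric] powr_powr powr_half_sqrt[symmetric])
  moreover have "2 * sqrt n * k \<le> 4 * sqrt n * k" by (intro mult_right_mono) auto
  ultimately have "r\<^sup>2 \<le> (2 * (real k powr (1/2) * real n powr (1/4)))\<^sup>2" using r2 by linarith
  then have "r \<le> 2 * (real k powr (1/2) * real n powr (1/4))"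
    by (rule power2_le_imp_le) simp
  then have "r / n \<le> 2 * (real k powr (1/2) * real n powr (1/4)) / n" by (intro divide_right_mono) auto
  also have "\<dots> = 2 * ?h"
  proof -
    have "real n = real n powr (1/4) * real n powr (3/4)" using n3 by (simp flip: powr_add)
    then have "real n powr (1/4) / n = 1 / real n powr (3/4)" using n3 by (simp add: field_simps)
    then have "2 * real k powr (1/2) * (real n powr (1/4) / n) = 2 * real k powr (1/2) * (1 / real n powr (3/4))"
      by (rule arg_cong)
    then show ?thesis by (simp only: times_divide_eq_right mult.right_neutral mult.assoc)
  qed
  finally have rh: "r / n \<le> 2 * ?h" .
  have b2: "real lam / n \<le> 6 * max ?h (\<kappa> powr 2)"
    using lrn mun rh by linarith

  let ?g = "max (\<kappa> powr (3/2)) ((1 / real n) powr (1/2))"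
  have b3: "real lam / n \<le> 125 * ?g"
  proof (cases "16 * k * mu < lam\<^sup>2")
    case False
    then have "real (lam\<^sup>2) \<le> real (16 * k * mu)" by (simp only: of_nat_le_iff)
    then have "real lam ^ 2 \<le> 16 * real k * mu" by simp
    also have "\<dots> \<le> 16 * real k * (4 * real k ^ 2 / real n)" using muk2 by (intro mult_left_mono) auto
    finally have l2: "real lam ^ 2 \<le> 64 * real k ^ 3 / n" by (simp add: power3_eq_cube power2_eq_square)
    have "(real lam / (8 * n))\<^sup>2 = real lam ^ 2 / (64 * real n ^ 2)" by (simp add: power_divide power_mult_distrib)
    also have "\<dots> \<le> (64 * real k ^ 3 / n) / (64 * real n ^ 2)" using l2 by (intro divide_right_mono) auto
    also have "\<dots> = \<kappa> powr 3" using \<kappa>0 n3 by (simp add: \<kappa>_def power_divide power3_eq_cube power2_eq_square)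
    finally have "real lam / (8 * n) \<le> \<kappa> powr (3 / real 2)"
      using \<kappa>0 by (intro power_le_imp_le_powr) auto
    then have "real lam / n \<le> 8 * \<kappa> powr (3/2)" by (simp add: field_simps)
    also have "\<dots> \<le> 125 * ?g" using powr_ge_zero[of \<kappa> "3/2"] by linarith
    finally show ?thesis .
  next
    case True
    have "k + 1 < n" using kn v(1) by linarith
    then have "mu * lam\<^sup>2 \<le> 8 * k\<^sup>2" using mu_bound[OF _ True] by simp
    then have "real (mu * lam\<^sup>2) \<le> real (8 * k\<^sup>2)" by (simp only: of_nat_le_iff)
    then have ml: "real mu * real lam ^ 2 \<le> 8 * real k ^ 2" by simp
    have "lam \<noteq> 0" using True by (cases lam) auto
    show ?thesis
    proof (cases "2 * (real lam + 1) \<le> k")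
      case half: True
      \<comment> \<open>Here \<open>k\<^sup>2\<close> is at most \<open>2 * n * mu\<close>, so
        \<open>mu\<close> cancels from \<open>ml\<close>.\<close>
      have "real k * (real k / 2) \<le> real k * (real k - real lam - 1)"
        using half by (intro mult_left_mono) auto
      also have "\<dots> \<le> n * real mu" unfolding id by (intro mult_right_mono) auto
      finally have "8 * real k ^ 2 \<le> real mu * (16 * n)"
        by (simp add: power2_eq_square mult.commute)
      then have "real mu * real lam ^ 2 \<le> real mu * (16 * n)" using ml by linarith
      then have l2: "real lam ^ 2 \<le> 16 * n" using mu1 by simp
      have "(real lam / (4 * n))\<^sup>2 = real lam ^ 2 / (16 * real n ^ 2)" by (simp add: power_divide power_mult_distrib)
      also have "\<dots> \<le> 16 * n / (16 * real n ^ 2)" using l2 by (intro divide_right_mono) auto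
      also have "\<dots> = (1 / real n) powr 1" using n3 by (simp add: power2_eq_square)
      finally have "real lam / (4 * n) \<le> (1 / real n) powr (1 / real 2)"
        by (intro power_le_imp_le_powr) auto
      then have "real lam / n \<le> 4 * (1 / real n) powr (1/2)" by (simp add: field_simps)
      also have "\<dots> \<le> 125 * ?g" using powr_ge_zero[of "1 / real n" "1/2"] by linarith
      finally show ?thesis .
    next
      case False
      then have "real k < 2 * real lam + 2" by (simp only: not_le distrib_left mult_1_right)
      moreover have "1 \<le> real lam" using \<open>lam \<noteq> 0\<close> by linarith
      ultimately have "real k \<le> 4 * real lam" by linarith
      then have "\<kappa> \<le> 4 * (real lam / n)" using n3 by (simp add: \<kappa>_def field_simps)
      then have "\<kappa> \<le> 24 * \<kappa> powr (4/3)" using b1 by linarith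
      also have "\<kappa> powr (4/3) = \<kappa> * \<kappa> powr (1/3)" using \<kappa>0 powr_add[of \<kappa> 1 "1/3"] by simp
      \<comment> \<open>The factor 24 is rounded to 25, whose power with exponent 3/2 is 125: the
        constant of the theorem.\<close>
      finally have "1 / 25 \<le> \<kappa> powr (1/3)" using \<kappa>0 by (simp add: field_simps)
      then have "(1 / 25) powr (3/2) \<le> (\<kappa> powr (1/3)) powr (3/2)" by (intro powr_mono2) auto
      then have "1 / 125 \<le> \<kappa> powr (1/2)"
      proof -
        have "(1 / 25 :: real) powr (3/2) = ((1 / 5) powr 2) powr (3/2)"
          by (simp add: power_divide)
        also have "\<dots> = (1 / 5) powr 3" by (subst powr_powr) simp
        finally have "(1 / 25 :: real) powr (3/2) = 1 / 125"
          by (simp add: power_divide)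
        then show ?thesis using \<open>(1 / 25) powr (3/2) \<le> _\<close> by (simp add: powr_powr)
      qed
      then have "\<kappa> * (1 / 125) \<le> \<kappa> * \<kappa> powr (1/2)" using \<kappa>0 by (intro mult_left_mono) auto
      also have "\<dots> = \<kappa> powr (3/2)" using \<kappa>0 powr_add[of \<kappa> 1 "1/2"] by simp
      finally have "\<kappa> \<le> 125 * \<kappa> powr (3/2)" by simp
      moreover have "real lam / n \<le> \<kappa>" using lk by (simp add: \<kappa>_def divide_right_mono)
      ultimately show ?thesis by (smt (verit) max.cobounded1)
    qed
  qed
  have "real lam / n \<le> 125 * \<kappa> powr (4/3)" using b1 powr_ge_zero[of \<kappa> "4/3"] by linarith
  moreover have "real lam / n \<le> 125 * max ?h (\<kappa> powr 2)"
    using b2 powr_ge_zero[of \<kappa> 2] by linarith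
  ultimately show ?thesis
    using b3 by (intro le_h_funI[OF \<kappa>_def]) auto
qed

end

theorem theorem20:
  "\<exists>C::real. C > 0 \<and>
     (\<forall>n E k lam mu r s.
        strongly_regular n E k lam mu \<longrightarrow>
        2 * real k \<le> real n - 1 \<longrightarrow>
        srg_eigenvalues n E k r s \<longrightarrow>
        r \<le> max (2 * (- s - 1) * (real mu + 1 + s) + s) (s * (s + 1) * (real mu + 1) / 2 - 1) \<longrightarrow>
        real lam / real n \<le> C * h_fun n k)"
proof (intro exI[of _ 125] conjI allI impI)
  fix n E k lam mu r s
  assume "strongly_regular n E k lam mu"
  then interpret srg n E k lam mu by unfold_locales
  assume "2 * real k \<le> real n - 1" "srg_eigenvalues n E k r s"
    "r \<le> max (2 * (- s - 1) * (real mu + 1 + s) + s) (s * (s + 1) * (real mu + 1) / 2 - 1)"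
  then show "real lam / real n \<le> 125 * h_fun n k" by (rule claw_bound_lambda)
qed simp

end
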